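(* Let $0<r<\frac12$. Then $\chi^{\mathrm{radial}}(A_r)$ is the least integer $N$ such that one can walk around the outside circumference of $A_r$ (the circle of radius $\frac12+r$ centered at the origin) using $N$ unit-chord steps, i.e. $$\chi^{\mathrm{radial}}(A_r)=\left\lceil \frac{2\pi}{\theta}\right\rceil,\qquad\text{where}\quad \theta=\arccos\left(1-\frac{1}{2\left(\frac12+r\right)^2}\right).$$
   Context: For $0<r<\frac12$, let $A_r=\{p\in\mathbb{R}^2:\ \frac12-r\le\|p\|\le\frac12+r\}$ with the Euclidean norm. A coloring of $A_r$ assigns a color to each point of $A_r$; it is proper if no two points of $A_r$ at distance exactly $1$ have the same color. A coloring of $A_r$ is called radial if there is a finite sequence of radii $r_1,r_2,\ldots,r_n=r_1$, in cyclic order around the annulus (a radius being a ray from the origin intersected with $A_r$), such that for each $i$ the open sector of $A_r$ strictly between the consecutive radii $r_i$ and $r_{i+1}$ is colored with a single color. Different sectors may share a color, and the points on the radii $r_i$ themselves (the boundaries between sectors) may be colored arbitrarily. $\chi^{\mathrm{radial}}(A_r)$ denotes the least number of colors needed for a proper radial coloring of $A_r$. A unit-chord step moves from one point of the outer circle to a point of the outer circle at distance exactly $1$, always going in the same rotational direction, so it advances by the central angle $\theta$; walking around the circumference with $N$ steps means that $N\theta\ge 2\pi$. *)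

theory Defs
  imports "HOL-Analysis.Analysis"
begin

definition annulus :: "real \<Rightarrow> (real^2) set" where
  "annulus r = {p. 1/2 - r \<le> norm p \<and> norm p \<le> 1/2 + r}"

definition unit_dir :: "real \<Rightarrow> real^2" where
  "unit_dir t = vector [cos t, sin t]"

definition annulus_radius :: "real \<Rightarrow> real \<Rightarrow> (real^2) set" where
  "annulus_radius r t = {s *\<^sub>R unit_dir t | s. 0 \<le> s} \<inter> annulus r"

definition open_sector :: "real \<Rightarrow> real \<Rightarrow> real \<Rightarrow> (real^2) set" where
  "open_sector r a b = (\<Union>t\<in>{a<..<b}. annulus_radius r t)"

definition proper_coloring :: "real \<Rightarrow> (real^2 \<Rightarrow> 'c) \<Rightarrow> bool" where
  "proper_coloring r c \<longleftrightarrow>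
     (\<forall>p\<in>annulus r. \<forall>q\<in>annulus r. dist p q = 1 \<longrightarrow> c p \<noteq> c q)"

text \<open>
  A closed cyclic sequence of radii is given by the lifted polar angles
  \<open>\<alpha> 0 < \<alpha> 1 < \<dots> < \<alpha> n = \<alpha> 0 + 2 * pi\<close> of its members, so the last radius is the first one again
  and there are \<open>n\<close> sectors. The condition \<open>n \<ge> 1\<close> need not be stated, as \<open>\<alpha> 0 \<noteq> \<alpha> 0 + 2 * pi\<close>.
  For \<open>n = 1\<close> the only sector is the annulus cut along one radius.
  Nothing is required of \<open>c\<close> on the radii themselves.
\<close>

definition radial_coloring :: "real \<Rightarrow> (real^2 \<Rightarrow> 'c) \<Rightarrow> bool" where
  "radial_coloring r c \<longleftrightarrow>
     (\<exists>(n::nat) \<alpha>. (\<forall>i<n. \<alpha> i < \<alpha> (Suc i)) \<and> \<alpha> n = \<alpha> 0 + 2 * pi \<and>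
        (\<forall>i<n. \<exists>k. \<forall>p\<in>open_sector r (\<alpha> i) (\<alpha> (Suc i)). c p = k))"

definition chi_radial :: "real \<Rightarrow> nat" where
  "chi_radial r =
     (LEAST k. \<exists>c :: real^2 \<Rightarrow> nat. c ` annulus r \<subseteq> {..<k} \<and>
                 radial_coloring r c \<and> proper_coloring r c)"

text \<open>
  A walk on the outer circle is given by the lifted polar angles \<open>\<beta> 0, \<dots>, \<beta> N\<close> of its points.
  The sign \<open>d\<close> is the common rotational direction of the steps. The central angle subtended by a
  chord is at most \<open>pi\<close>; without that bound a step could also go the long way round.
\<close>

definition walks_around :: "real \<Rightarrow> nat \<Rightarrow> bool" where
  "walks_around r N \<longleftrightarrow>
     (\<exists>d\<in>{1, -1}. \<exists>\<beta> :: nat \<Rightarrow> real.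
        (\<forall>i<N. 0 < d * (\<beta> (Suc i) - \<beta> i) \<and> d * (\<beta> (Suc i) - \<beta> i) \<le> pi \<and>
           dist ((1/2 + r) *\<^sub>R unit_dir (\<beta> (Suc i))) ((1/2 + r) *\<^sub>R unit_dir (\<beta> i)) = 1) \<and>
        2 * pi \<le> d * (\<beta> N - \<beta> 0))"

end

theory Submission imports Defs begin

text \<open>
  Write \<open>R = 1/2 + r\<close> and let \<open>\<theta>\<close> be the central angle of a unit chord of the outer circle; then
  \<open>0 < \<theta> < \<pi>\<close>. Every admissible step of a walk turns by exactly \<open>\<theta>\<close>, so the least length of a walk
  is the least \<open>N\<close> with \<open>2 * pi \<le> N * \<theta>\<close>, which is the stated ceiling. What has to be shown is that
  \<open>k\<close> colours suffice for a proper radial colouring exactly when \<open>2 * pi \<le> k * \<theta>\<close>.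

  If \<open>2 * pi \<le> k * \<theta>\<close>, cut the annulus into \<open>k\<close> equal half-open sectors and give each its own
  colour. Two points of one sector differ in direction by less than \<open>\<theta>\<close>, and in the annulus this
  forces their distance below 1 (\<open>dist_less_one_if_close_directions\<close>).

  Conversely, a radial colouring is constant along the radius in all but countably many directions.
  If two such directions are at least \<open>\<theta>\<close> apart, then on their radii there are points at a common
  distance from the origin, between \<open>1/2\<close> and \<open>R\<close>, that are at distance 1 from each other; hence the
  two radii have different colours (\<open>far_directions_differ\<close>). So the colouring restricts to a colouring
  of the circular graph that joins directions at least \<open>\<theta>\<close> apart. Counting colours by the total
  angle they occupy would need a bound for sets that are not arcs; finite regular polygons avoid
  this. If \<open>k * \<theta> < 2 * pi\<close>, then for large \<open>q\<close> the regular polygon with \<open>p = k * q + 1\<close>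
  vertices satisfies \<open>\<theta> \<le> 2 * pi * q / p\<close>, so vertices at least \<open>q\<close> steps apart get different
  colours. For \<open>2 * q \<le> p\<close> a set of vertices that are pairwise less than \<open>q\<close> steps apart has at most
  \<open>q\<close> elements (\<open>card_close_vertices_le\<close>), so \<open>k\<close> colours cover at most \<open>k * q < p\<close> vertices.
  The polygon is rotated so that its vertices miss the countably many exceptional directions.
\<close>

section \<open>Distances in polar coordinates\<close>

lemma inner_unit_dir: "unit_dir s \<bullet> unit_dir t = cos (s - t)"
  by (simp add: unit_dir_def inner_vec_def sum_2 vector_2 cos_diff)

lemma norm_unit_dir [simp]: "norm (unit_dir t) = 1"
  by (simp add: norm_eq_sqrt_inner inner_unit_dir)

lemma unit_dir_periodic: "unit_dir (t + 2 * pi * of_int m) = unit_dir t"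
proof -
  have "cos (t + 2 * pi * of_int m) = cos t" "sin (t + 2 * pi * of_int m) = sin t"
    by (simp_all add: cos_add sin_add)
  then show ?thesis by (simp add: unit_dir_def)
qed

lemma dist_polar:
  "(dist (a *\<^sub>R unit_dir s) (b *\<^sub>R unit_dir t))\<^sup>2 = a\<^sup>2 + b\<^sup>2 - 2 * a * b * cos (s - t)"
proof -
  have "cos (t - s) = cos (s - t)"
    using cos_minus[of "s - t"] by simp
  then show ?thesis
    unfolding dist_norm power2_norm_eq_inner
    by (simp add: inner_diff_left inner_diff_right inner_unit_dir power2_eq_square algebra_simps)
qed

lemma polar_form:
  fixes p :: "real^2"
  obtains t where "0 \<le> t" "t < 2 * pi" "p = norm p *\<^sub>R unit_dir t"
proof -
  define z where "z = Complex (p $ 1) (p $ 2)"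
  have n: "norm p = cmod z"
    by (simp add: z_def norm_vec_def L2_set_def sum_2 cmod_def)
  have z: "z = of_real (cmod z) * exp (\<i> * of_real (Arg2pi z))"
    using Arg2pi[of z] by (simp add: is_Arg_def)
  have "Re z = cmod z * cos (Arg2pi z)" "Im z = cmod z * sin (Arg2pi z)"
    using arg_cong[OF z, of Re] arg_cong[OF z, of Im] by (simp_all add: Re_exp Im_exp)
  then have "p = norm p *\<^sub>R unit_dir (Arg2pi z)"
    by (simp add: n vec_eq_iff forall_2 unit_dir_def vector_2 z_def)
  then show thesis
    using that Arg2pi[of z] by blast
qed

section \<open>The central angle of a unit chord\<close>

definition chord_angle :: "real \<Rightarrow> real" where
  "chord_angle R = arccos (1 - 1 / (2 * R\<^sup>2))"

context
  fixes R :: real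
  assumes R: "1/2 < R"
begin

lemma quarter_less_square: "1/4 < R\<^sup>2"
  using power_strict_mono[OF R, of 2] by (simp add: power2_eq_square)

lemma chord_cosine_bounds: "- 1 < 1 - 1 / (2 * R\<^sup>2)" "1 - 1 / (2 * R\<^sup>2) < 1"
proof -
  have "0 < 2 * R\<^sup>2" using R by simp
  moreover have "1 / (2 * R\<^sup>2) < 2"
    using quarter_less_square by (subst pos_divide_less_eq) auto
  ultimately show "- 1 < 1 - 1 / (2 * R\<^sup>2)" "1 - 1 / (2 * R\<^sup>2) < 1"
    by auto
qed

lemma cos_chord_angle: "cos (chord_angle R) = 1 - 1 / (2 * R\<^sup>2)"
  using chord_cosine_bounds unfolding chord_angle_def by (intro cos_arccos) auto

lemma chord_angle_bounds: "0 < chord_angle R" "chord_angle R < pi"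
  using arccos_lt_bounded[OF chord_cosine_bounds] by (simp_all add: chord_angle_def)

lemma unit_chord_iff:
  assumes "0 \<le> s - t" "s - t \<le> pi"
  shows "dist (R *\<^sub>R unit_dir s) (R *\<^sub>R unit_dir t) = 1 \<longleftrightarrow> s - t = chord_angle R"
proof -
  have "dist (R *\<^sub>R unit_dir s) (R *\<^sub>R unit_dir t) = 1 \<longleftrightarrow>
      (dist (R *\<^sub>R unit_dir s) (R *\<^sub>R unit_dir t))\<^sup>2 = 1"
    by (simp add: power2_eq_1_iff)
      (metis neg_0_le_iff_le not_one_le_zero zero_le_dist)
  also have "\<dots> \<longleftrightarrow> cos (s - t) = cos (chord_angle R)"
    using R unfolding dist_polar cos_chord_angle by (simp add: field_simps power2_eq_square) argo
  also have "\<dots> \<longleftrightarrow> s - t = chord_angle R"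
    using assms chord_angle_bounds cos_inj_pi[of "s - t" "chord_angle R"] by auto
  finally show ?thesis .
qed

end

text \<open>
  Both terms grow with the larger radius \<open>a\<close>, so it suffices to look at \<open>a = R\<close>, where
  \<open>R - b \<le> R \<le> 1 / R\<close> does it.
\<close>

lemma unit_chord_angle_bound:
  fixes a b R :: real
  assumes "0 < b" "b \<le> a" "a \<le> R" "R < 1"
  shows "(a - b)\<^sup>2 + a * b / R\<^sup>2 \<le> 1"
proof -
  have R: "0 < R" using assms by linarith
  have "R * R \<le> 1"
    using assms R mult_mono[of R 1 R 1] by simp
  then have "R \<le> 1 / R"
    using R by (simp add: field_simps)
  have "(a - b)\<^sup>2 \<le> (R - b)\<^sup>2"
    using assms by (intro power_mono) auto
  also have "\<dots> \<le> (R - b) * (1 / R)"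
    using assms \<open>R \<le> 1 / R\<close> unfolding power2_eq_square by (intro mult_left_mono) linarith+
  finally have "(a - b)\<^sup>2 \<le> (R - b) * (1 / R)" .
  moreover have "a * b / R\<^sup>2 \<le> R * b / R\<^sup>2"
    using assms by (intro divide_right_mono mult_right_mono) auto
  moreover have "R * b / R\<^sup>2 = b / R"
    using R by (simp add: power2_eq_square)
  moreover have "(R - b) * (1 / R) + b / R = 1"
    using R by (simp add: field_simps)
  ultimately show ?thesis
    by linarith
qed

text \<open>
  For fixed radii \<open>a\<close> and \<open>b\<close> the distance grows with the angle, and at the angle \<open>chord_angle R\<close> its
  square is \<open>(a - b)\<^sup>2 + a * b / R\<^sup>2\<close>, by the law of cosines.
\<close>

lemma dist_less_one_if_close_directions:
  assumes R: "1/2 < R" "R < 1"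
    and "0 < a" "a \<le> R" "0 < b" "b \<le> R" "\<bar>s - t\<bar> < chord_angle R"
  shows "dist (a *\<^sub>R unit_dir s) (b *\<^sub>R unit_dir t) < 1"
proof -
  have "cos (chord_angle R) < cos \<bar>s - t\<bar>"
    using assms chord_angle_bounds[OF R(1)] by (intro cos_monotone_0_pi) auto
  then have "1 - 1 / (2 * R\<^sup>2) < cos (s - t)"
    using cos_chord_angle[OF R(1)] by simp
  then have "2 * a * b * (1 - 1 / (2 * R\<^sup>2)) < 2 * a * b * cos (s - t)"
    using assms by (intro mult_strict_left_mono) auto
  moreover have "2 * a * b * (1 - 1 / (2 * R\<^sup>2)) = 2 * a * b - a * b / R\<^sup>2"
    by (simp add: algebra_simps)
  moreover have "(a - b)\<^sup>2 + a * b / R\<^sup>2 \<le> 1"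
  proof (cases "b \<le> a")
    case True
    then show ?thesis using unit_chord_angle_bound[of b a R] assms by simp
  next
    case False
    then show ?thesis using unit_chord_angle_bound[of a b R] assms
      by (simp add: power2_commute mult.commute)
  qed
  ultimately have "(dist (a *\<^sub>R unit_dir s) (b *\<^sub>R unit_dir t))\<^sup>2 < 1\<^sup>2"
    unfolding dist_polar by (simp add: power2_diff)
  then show ?thesis
    by (rule power_less_imp_less_base) simp
qed

section \<open>Walks\<close>

lemma walks_around_iff:
  assumes "0 < r"
  shows "walks_around r N \<longleftrightarrow> 2 * pi \<le> real N * chord_angle (1/2 + r)"
proof -
  have R: "1/2 < 1/2 + r" using assms by simp
  let ?\<theta> = "chord_angle (1/2 + r)"
  show ?thesis
  proof
    assume "walks_around r N"
    then obtain d \<beta> where d: "d = 1 \<or> d = (-1::real)"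
      and step: "\<And>i. i < N \<Longrightarrow> 0 < d * (\<beta> (Suc i) - \<beta> i) \<and> d * (\<beta> (Suc i) - \<beta> i) \<le> pi \<and>
           dist ((1/2 + r) *\<^sub>R unit_dir (\<beta> (Suc i))) ((1/2 + r) *\<^sub>R unit_dir (\<beta> i)) = 1"
      and total: "2 * pi \<le> d * (\<beta> N - \<beta> 0)"
      unfolding walks_around_def by blast
    have turn: "d * (\<beta> (Suc i) - \<beta> i) = ?\<theta>" if "i < N" for i
      using d step[OF that] unit_chord_iff[OF R, of "\<beta> (Suc i)" "\<beta> i"]
        unit_chord_iff[OF R, of "\<beta> i" "\<beta> (Suc i)"]
      by (auto simp: dist_commute)
    have "d * (\<beta> N - \<beta> 0) = (\<Sum>i<N. d * (\<beta> (Suc i) - \<beta> i))"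
      by (simp add: sum_lessThan_telescope flip: sum_distrib_left)
    also have "\<dots> = real N * ?\<theta>"
      by (simp add: turn)
    finally show "2 * pi \<le> real N * ?\<theta>"
      using total by simp
  next
    assume "2 * pi \<le> real N * ?\<theta>"
    moreover have "real (Suc i) * ?\<theta> - real i * ?\<theta> = ?\<theta>" for i
      by (simp add: algebra_simps)
    ultimately show "walks_around r N"
      unfolding walks_around_def using chord_angle_bounds[OF R]
      by (intro bexI[of _ 1] exI[of _ "\<lambda>i. real i * ?\<theta>"])
        (auto simp: unit_chord_iff[OF R] simp del: of_nat_Suc)
  qed
qed

section \<open>Colouring with equal sectors\<close>

text \<open>
  Half-open sectors decide the colours on the cutting radii, so that two points of one colour
  always differ in direction by strictly less than \<open>2 * pi / k \<le> chord_angle (1/2 + r)\<close>.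
\<close>

lemma ex_sector_coloring:
  assumes r: "0 < r" "r < 1/2" and k: "2 * pi \<le> real k * chord_angle (1/2 + r)"
  shows "\<exists>c :: real^2 \<Rightarrow> nat. c ` annulus r \<subseteq> {..<k} \<and> radial_coloring r c \<and> proper_coloring r c"
proof -
  let ?\<theta> = "chord_angle (1/2 + r)"
  have R: "1/2 < 1/2 + r" "1/2 + r < 1" using r by auto
  have "k \<noteq> 0" using k pi_gt_zero by (intro notI) simp
  then have kpos: "0 < real k" by simp
  define ang where
    "ang p = (SOME t. 0 \<le> t \<and> t < 2 * pi \<and> p = norm p *\<^sub>R unit_dir t)" for p :: "real^2"
  have "0 \<le> ang p \<and> ang p < 2 * pi \<and> p = norm p *\<^sub>R unit_dir (ang p)" for p
    unfolding ang_def by (rule someI_ex) (metis polar_form)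
  then have ang: "0 \<le> ang p" "ang p < 2 * pi" and polar: "norm p *\<^sub>R unit_dir (ang p) = p" for p
    by metis+
  define c where "c p = nat \<lfloor>ang p * k / (2 * pi)\<rfloor>" for p
  have c_iff: "c p = i \<longleftrightarrow> 2 * pi * i / k \<le> ang p \<and> ang p < 2 * pi * Suc i / k" for p i
  proof -
    have "c p = i \<longleftrightarrow> \<lfloor>ang p * k / (2 * pi)\<rfloor> = int i"
      using ang[of p] unfolding c_def by (subst nat_eq_iff) auto
    also have "\<dots> \<longleftrightarrow> 2 * pi * i / k \<le> ang p \<and> ang p < 2 * pi * Suc i / k"
      using kpos pi_gt_zero by (simp add: floor_eq_iff field_simps)
    finally show ?thesis .
  qed
  have norm: "0 < norm p" "norm p \<le> 1/2 + r" if "p \<in> annulus r" for p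
    using that r by (auto simp: annulus_def)
  have bound: "c p < k" for p
  proof -
    have "2 * pi * c p / k < 2 * pi"
      using c_iff[of p "c p"] ang[of p] by linarith
    then show ?thesis
      using kpos by (simp add: field_simps)
  qed
  have proper: "proper_coloring r c"
    unfolding proper_coloring_def
  proof (intro ballI impI notI)
    fix p q assume p: "p \<in> annulus r" and q: "q \<in> annulus r" and "dist p q = 1" "c p = c q"
    have "2 * pi * Suc (c q) / k - 2 * pi * c q / k = 2 * pi / k"
      using kpos by (simp add: field_simps)
    moreover have "2 * pi / k \<le> ?\<theta>"
      using k kpos by (simp add: field_simps)
    ultimately have "\<bar>ang p - ang q\<bar> < ?\<theta>"
      using c_iff[of p "c q"] c_iff[of q "c q"] \<open>c p = c q\<close> by linarith
    then have "dist (norm p *\<^sub>R unit_dir (ang p)) (norm q *\<^sub>R unit_dir (ang q)) < 1"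
      using dist_less_one_if_close_directions[OF R] norm[OF p] norm[OF q] by blast
    then show False
      using \<open>dist p q = 1\<close> by (simp add: polar)
  qed
  have ang_unique: "ang p = t"
    if "p \<in> annulus_radius r t" "0 \<le> t" "t < 2 * pi" for p t
  proof -
    have "\<exists>s\<ge>0. p = s *\<^sub>R unit_dir t" and "p \<in> annulus r"
      using that(1) unfolding annulus_radius_def by auto
    then obtain s where s: "0 \<le> s" "p = s *\<^sub>R unit_dir t" "p \<in> annulus r"
      by metis
    have "norm p = s" using s by simp
    then have "s *\<^sub>R unit_dir (ang p) = s *\<^sub>R unit_dir t"
      using polar[of p] s(2) by simp
    then have "unit_dir (ang p) = unit_dir t"
      using norm(1)[OF s(3)] \<open>norm p = s\<close> by simp
    then have "cos (ang p - t) = 1"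
      using inner_unit_dir[of "ang p" t] inner_unit_dir[of t t] by simp
    then obtain n :: int where n: "ang p - t = of_int n * (2 * pi)"
      by (auto simp: cos_one_2pi_int mult.assoc)
    have "\<bar>ang p - t\<bar> < 1 * (2 * pi)"
      using that ang[of p] by linarith
    then have "\<bar>real_of_int n\<bar> < 1"
      unfolding n abs_mult using pi_gt_zero by simp
    then have "n = 0" by linarith
    then show ?thesis using n by simp
  qed
  have "radial_coloring r c"
    unfolding radial_coloring_def
  proof (intro exI conjI allI impI)
    show "2 * pi * real i / k < 2 * pi * real (Suc i) / k" for i
      using kpos by (simp add: field_simps)
    show "2 * pi * real k / k = 2 * pi * real 0 / k + 2 * pi"
      using kpos by simp
  next
    fix i assume "i < k"
    show "\<forall>p\<in>open_sector r (2 * pi * real i / k) (2 * pi * real (Suc i) / k). c p = i"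
    proof
      fix p assume "p \<in> open_sector r (2 * pi * real i / k) (2 * pi * real (Suc i) / k)"
      then obtain t where t: "2 * pi * real i / k < t" "t < 2 * pi * real (Suc i) / k"
        and p: "p \<in> annulus_radius r t"
        unfolding open_sector_def by auto
      have "0 \<le> 2 * pi * real i / k" by simp
      moreover have "2 * pi * real (Suc i) / k \<le> 2 * pi * real k / k"
        using \<open>i < k\<close> by (intro divide_right_mono mult_left_mono) auto
      moreover have "2 * pi * real k / k = 2 * pi"
        using kpos by simp
      ultimately have "ang p = t"
        using ang_unique[OF p] t by linarith
      then show "c p = i"
        using t by (simp add: c_iff)
    qed
  qed
  then show ?thesis
    using proper bound by blast
qed

section \<open>Directions of constant colour\<close>

lemma interval_containing:
  fixes \<alpha> :: "nat \<Rightarrow> 'a::linorder"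
  assumes "\<alpha> 0 \<le> x" "x < \<alpha> n"
  shows "\<exists>i<n. \<alpha> i \<le> x \<and> x < \<alpha> (Suc i)"
  using assms(2)
proof (induction n)
  case 0
  then show ?case using assms(1) by simp
next
  case (Suc n)
  then show ?case by (cases "x < \<alpha> n") (auto intro: less_SucI)
qed

text \<open>The exceptional directions are those of the cutting radii, with all their lifts.\<close>

lemma radial_coloring_constant_on_radii:
  assumes "radial_coloring r c"
  obtains B where "countable B" "\<And>t. t \<notin> B \<Longrightarrow> c constant_on annulus_radius r t"
proof -
  obtain n :: nat and \<alpha> where n: "\<alpha> n = \<alpha> 0 + 2 * pi"
    and sector: "\<And>i. i < n \<Longrightarrow> \<exists>k. \<forall>p\<in>open_sector r (\<alpha> i) (\<alpha> (Suc i)). c p = k"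
    using assms unfolding radial_coloring_def by blast
  define B where "B = (\<Union>i\<in>UNIV. \<Union>m\<in>(UNIV::int set). {\<alpha> i - 2 * pi * of_int m})"
  have "c constant_on annulus_radius r t" if "t \<notin> B" for t
  proof -
    define m where "m = - \<lfloor>(t - \<alpha> 0) / (2 * pi)\<rfloor>"
    define x where "x = t + 2 * pi * of_int m"
    have "of_int (- m) \<le> (t - \<alpha> 0) / (2 * pi)" "(t - \<alpha> 0) / (2 * pi) < of_int (- m) + 1"
      unfolding m_def by simp_all
    then have "\<alpha> 0 \<le> x" "x < \<alpha> n"
      by (simp_all add: x_def n field_simps)
    then obtain i where i: "i < n" "\<alpha> i \<le> x" "x < \<alpha> (Suc i)"
      using interval_containing by blast
    have "x \<noteq> \<alpha> i"
    proof
      assume "x = \<alpha> i"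
      then have "t = \<alpha> i - 2 * pi * of_int m"
        by (simp add: x_def)
      then show False using that unfolding B_def by blast
    qed
    then have "annulus_radius r x \<subseteq> open_sector r (\<alpha> i) (\<alpha> (Suc i))"
      using i unfolding open_sector_def by force
    moreover have "annulus_radius r x = annulus_radius r t"
      by (simp add: annulus_radius_def x_def unit_dir_periodic)
    ultimately show ?thesis
      using sector[OF i(1)] unfolding constant_on_def by blast
  qed
  moreover have "countable B"
    unfolding B_def by auto
  ultimately show thesis
    using that by blast
qed

text \<open>
  On two radii at an angle \<open>\<phi> \<le> \<pi>\<close> the points at distance \<open>\<rho>\<close> from the origin are a unit apart when
  \<open>\<rho>\<^sup>2 = 1 / (2 * (1 - cos \<phi>))\<close>. The lower bound \<open>1/2 \<le> \<rho>\<close> is automatic, and \<open>\<rho> \<le> 1/2 + r\<close> says that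
  \<open>\<phi>\<close> is at least the chord angle.
\<close>

lemma far_directions_differ:
  assumes r: "0 < r" "r < 1/2" and "proper_coloring r c"
    and s: "c constant_on annulus_radius r s" and t: "c constant_on annulus_radius r t"
    and far: "cos (s - t) \<le> cos (chord_angle (1/2 + r))"
  shows "c ((1/2 + r) *\<^sub>R unit_dir s) \<noteq> c ((1/2 + r) *\<^sub>R unit_dir t)"
proof -
  define R where "R = 1/2 + r"
  define u where "u = 1 - cos (s - t)"
  define \<rho> where "\<rho> = sqrt (1 / (2 * u))"
  have R: "1/2 < R" using r by (simp add: R_def)
  then have R2: "0 < R\<^sup>2" by simp
  have u: "1 / (2 * R\<^sup>2) \<le> u" "u \<le> 2"
    using far cos_chord_angle[OF R] cos_ge_minus_one[of "s - t"] by (auto simp: u_def R_def)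
  have "0 < 1 / (2 * R\<^sup>2)" using R2 by simp
  then have upos: "0 < u" using u by linarith
  have \<rho>2: "\<rho>\<^sup>2 = 1 / (2 * u)"
    using upos by (simp add: \<rho>_def)
  have "1/2 \<le> \<rho>"
    unfolding \<rho>_def using u upos by (intro real_le_rsqrt) (simp add: field_simps power2_eq_square)
  moreover have "\<rho> \<le> R"
    unfolding \<rho>_def using u upos R R2 by (intro real_le_lsqrt) (simp_all add: field_simps)
  ultimately have on_radius: "\<rho> *\<^sub>R unit_dir x \<in> annulus_radius r x"
    "R *\<^sub>R unit_dir x \<in> annulus_radius r x" for x
    using r unfolding annulus_radius_def annulus_def R_def by auto
  have "(dist (\<rho> *\<^sub>R unit_dir s) (\<rho> *\<^sub>R unit_dir t))\<^sup>2 = 2 * \<rho>\<^sup>2 * u"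
    unfolding dist_polar u_def by (simp add: algebra_simps power2_eq_square)
  also have "\<dots> = 1"
    using upos by (simp add: \<rho>2)
  finally have "dist (\<rho> *\<^sub>R unit_dir s) (\<rho> *\<^sub>R unit_dir t) = 1"
    using zero_le_dist[of "\<rho> *\<^sub>R unit_dir s" "\<rho> *\<^sub>R unit_dir t"] by (auto simp: power2_eq_1_iff)
  then have "c (\<rho> *\<^sub>R unit_dir s) \<noteq> c (\<rho> *\<^sub>R unit_dir t)"
    using \<open>proper_coloring r c\<close> on_radius(1)
    unfolding proper_coloring_def annulus_radius_def by blast
  moreover have "c (R *\<^sub>R unit_dir s) = c (\<rho> *\<^sub>R unit_dir s)"
    "c (R *\<^sub>R unit_dir t) = c (\<rho> *\<^sub>R unit_dir t)"
    using s t on_radius unfolding constant_on_def by metis+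
  ultimately show ?thesis
    unfolding R_def by simp
qed

section \<open>Regular polygons\<close>

text \<open>
  With the first vertex of \<open>A\<close> as origin, every vertex of \<open>A\<close> is \<open>i\<close> or \<open>i + (p - q)\<close> for some
  \<open>i < q\<close>. These two vertices are \<open>q\<close> steps apart around the polygon, so \<open>A\<close> contains at most one of
  them, and sending both to \<open>i\<close> is injective on \<open>A\<close>.
\<close>

lemma card_close_vertices_le:
  fixes A :: "nat set"
  assumes A: "A \<subseteq> {..<p}" and "0 < q" and p: "2 * q \<le> p"
    and close: "\<And>i j. i \<in> A \<Longrightarrow> j \<in> A \<Longrightarrow> i < j \<Longrightarrow> q \<le> j - i \<Longrightarrow> j - i \<le> p - q \<Longrightarrow> False"
  shows "card A \<le> q"
proof (cases "A = {}")
  case False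
  have fin: "finite A" using A finite_subset by blast
  define m where "m = Min A"
  have m: "m \<in> A" "\<And>x. x \<in> A \<Longrightarrow> m \<le> x"
    using fin False by (auto simp: m_def)
  define g where "g x = (if x - m < q then x - m else x - m - (p - q))" for x
  have split: "x - m < q \<or> p - q < x - m \<and> x - m < p" if "x \<in> A" for x
  proof -
    have "x < p" using A that by blast
    moreover have "\<not> (q \<le> x - m \<and> x - m \<le> p - q)"
      using close[OF m(1) that] \<open>0 < q\<close> by fastforce
    ultimately show ?thesis by linarith
  qed
  have "inj_on g A"
  proof (rule inj_onI)
    fix x y assume xy: "x \<in> A" "y \<in> A" "g x = g y"
    note facts = split[OF xy(1)] split[OF xy(2)] m(2)[OF xy(1)] m(2)[OF xy(2)] p xy(3)
    have "q \<le> p - q" using p by linarith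
    then have "\<not> (y - x = p - q \<and> x < y)" "\<not> (x - y = p - q \<and> y < x)"
      using close[of x y] close[of y x] xy by auto
    then show "x = y"
      using facts unfolding g_def by (auto split: if_splits)
  qed
  moreover have "g ` A \<subseteq> {..<q}"
    using split p unfolding g_def by (auto split: if_splits) fastforce
  ultimately show ?thesis
    using card_inj_on_le[of g A "{..<q}"] by simp
qed simp

lemma cos_le_cos_of_far:
  assumes "0 \<le> \<theta>" "\<theta> \<le> x" "x \<le> 2 * pi - \<theta>"
  shows "cos x \<le> cos \<theta>"
proof (cases "x \<le> pi")
  case True
  then show ?thesis using assms by (intro cos_monotone_0_pi_le) auto
next
  case False
  have "cos x = cos (2 * pi - x)" by simp
  also have "\<dots> \<le> cos \<theta>" using False assms by (intro cos_monotone_0_pi_le) auto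
  finally show ?thesis .
qed

lemma radial_coloring_lower_bound:
  fixes c :: "real^2 \<Rightarrow> nat"
  assumes r: "0 < r" "r < 1/2" and "2 \<le> k"
    and k: "c ` annulus r \<subseteq> {..<k}" and radial: "radial_coloring r c" and proper: "proper_coloring r c"
  shows "2 * pi \<le> real k * chord_angle (1/2 + r)"
proof (rule ccontr)
  let ?\<theta> = "chord_angle (1/2 + r)"
  assume "\<not> ?thesis"
  then have gap: "0 < 2 * pi - real k * ?\<theta>" by simp
  have \<theta>: "0 < ?\<theta>" using chord_angle_bounds[of "1/2 + r"] r by simp
  \<comment> \<open>So large that the chord spanning \<open>q\<close> sides of the \<open>p\<close>-gon subtends at least \<open>\<theta>\<close>.\<close>
  obtain q :: nat where q: "?\<theta> < real q * (2 * pi - real k * ?\<theta>)"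
    using reals_Archimedean3[OF gap] by blast
  define p where "p = k * q + 1"
  have ppos: "0 < real p" unfolding p_def of_nat_0_less_iff by simp
  have "0 < q" using q \<theta> by (cases "q = 0") auto
  have p2q: "2 * q \<le> p"
    using mult_le_mono1[OF \<open>2 \<le> k\<close>, of q] unfolding p_def by linarith
  have "real p * ?\<theta> \<le> 2 * pi * q"
    using q by (simp add: p_def algebra_simps)
  then have q_steps: "?\<theta> \<le> 2 * pi * q / p"
    using ppos by (simp add: field_simps)
  obtain B where "countable B" and B: "\<And>t. t \<notin> B \<Longrightarrow> c constant_on annulus_radius r t"
    using radial_coloring_constant_on_radii[OF radial] by blast
  have "countable (\<Union>i\<in>(UNIV::nat set). (\<lambda>b. b - 2 * pi * real i / p) ` B)"
    using \<open>countable B\<close> by auto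
  then obtain t where t: "t \<notin> (\<Union>i\<in>(UNIV::nat set). (\<lambda>b. b - 2 * pi * real i / p) ` B)"
    using uncountable_UNIV_real by (metis UNIV_eq_I)
  define v where "v i = t + 2 * pi * real i / p" for i
  have "v i \<notin> B" for i
  proof
    assume "v i \<in> B"
    moreover have "t = v i - 2 * pi * real i / p" by (simp add: v_def)
    ultimately show False using t by blast
  qed
  then have v: "c constant_on annulus_radius r (v i)" for i
    using B by blast
  define col where "col i = c ((1/2 + r) *\<^sub>R unit_dir (v i))" for i
  have col: "col i < k" for i
    using k r by (auto simp: col_def annulus_def image_subset_iff)
  have far: "col j \<noteq> col i" if "i < j" "q \<le> j - i" "j - i \<le> p - q" for i j
  proof -
    have vv: "v j - v i = 2 * pi * real (j - i) / p"
      using that by (simp add: v_def of_nat_diff diff_divide_distrib right_diff_distrib)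
    have "2 * pi * q / p \<le> 2 * pi * real (j - i) / p"
      using that by (intro divide_right_mono mult_left_mono) auto
    moreover have "2 * pi * real (j - i) / p \<le> 2 * pi * real (p - q) / p"
      using that by (intro divide_right_mono mult_left_mono) auto
    moreover have "2 * pi * real (p - q) / p = 2 * pi - 2 * pi * q / p"
      using p2q ppos by (simp add: of_nat_diff field_simps)
    ultimately have "cos (v j - v i) \<le> cos ?\<theta>"
      using q_steps \<theta> unfolding vv by (intro cos_le_cos_of_far) linarith+
    then show ?thesis
      unfolding col_def by (rule far_directions_differ[OF r proper v v])
  qed
  have class_bound: "card {i\<in>{..<p}. col i = a} \<le> q" for a
    using far p2q \<open>0 < q\<close> by (intro card_close_vertices_le) fastforce+
  have "{..<p} = (\<Union>a<k. {i\<in>{..<p}. col i = a})"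
    using col by auto
  then have "p = card (\<Union>a<k. {i\<in>{..<p}. col i = a})"
    by (metis card_lessThan)
  also have "\<dots> \<le> (\<Sum>a<k. card {i\<in>{..<p}. col i = a})"
    by (rule card_UN_le) simp
  also have "\<dots> \<le> (\<Sum>a<k. q)"
    by (intro sum_mono class_bound)
  finally show False
    by (simp add: p_def)
qed

section \<open>The radial chromatic number\<close>

theorem theorem6:
  fixes r :: real
  assumes "0 < r" and "r < 1/2"
  shows "chi_radial r = (LEAST N. walks_around r N) \<and>
         int (chi_radial r) = \<lceil>2 * pi / arccos (1 - 1 / (2 * (1/2 + r)^2))\<rceil>"
proof -
  let ?\<theta> = "chord_angle (1/2 + r)"
  have \<theta>: "0 < ?\<theta>" "?\<theta> < pi"
    using chord_angle_bounds[of "1/2 + r"] assms by auto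
  have colorable_iff: "(\<exists>c :: real^2 \<Rightarrow> nat. c ` annulus r \<subseteq> {..<k} \<and> radial_coloring r c \<and>
      proper_coloring r c) \<longleftrightarrow> 2 * pi \<le> real k * ?\<theta>" for k
  proof
    assume "\<exists>c :: real^2 \<Rightarrow> nat. c ` annulus r \<subseteq> {..<k} \<and> radial_coloring r c \<and> proper_coloring r c"
    then obtain c :: "real^2 \<Rightarrow> nat" where c: "c ` annulus r \<subseteq> {..<k}" "radial_coloring r c"
      "proper_coloring r c" by blast
    \<comment> \<open>Fewer than two colours would be two colours too, but two colours never suffice as \<open>\<theta> < \<pi>\<close>.\<close>
    have "c ` annulus r \<subseteq> {..<max 2 k}" using c(1) by fastforce
    then have *: "2 * pi \<le> real (max 2 k) * ?\<theta>"
      using radial_coloring_lower_bound[OF assms, of "max 2 k" c] c by simp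
    show "2 * pi \<le> real k * ?\<theta>"
    proof (cases "k \<le> 2")
      case True
      then show ?thesis using * \<theta> by (simp add: max_absorb1)
    next
      case False
      then show ?thesis using * by (simp add: max_absorb2)
    qed
  qed (rule ex_sector_coloring[OF assms])
  have "chi_radial r = (LEAST k. 2 * pi \<le> real k * ?\<theta>)"
    unfolding chi_radial_def colorable_iff ..
  moreover have "(LEAST N. walks_around r N) = (LEAST k. 2 * pi \<le> real k * ?\<theta>)"
    using walks_around_iff[OF assms(1)] by simp
  moreover have "(LEAST k. 2 * pi \<le> real k * ?\<theta>) = nat \<lceil>2 * pi / ?\<theta>\<rceil>"
  proof -
    have "2 * pi \<le> real k * ?\<theta> \<longleftrightarrow> nat \<lceil>2 * pi / ?\<theta>\<rceil> \<le> k" for k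
      using \<theta> by (simp only: nat_le_iff ceiling_le_iff of_int_of_nat_eq pos_divide_le_eq)
    then show ?thesis by (intro Least_equality) blast+
  qed
  moreover have "0 \<le> 2 * pi / ?\<theta>" using \<theta> by simp
  ultimately show ?thesis
    by (simp add: chord_angle_def)
qed

end
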